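(* Suppose $f(1+x)=\sum_{k\ge1}c_kx^k$ is a power series with inverse $f^{-1}(x)=1+\sum_{k\ge1}b_kx^k$, where $b_1=1/c_1$. Let $\mathrm g$ be a grading on $\mathbb A^*$ preserved by the quasi-shuffle product, let $n\in\mathbb N$, and let $\pi_{\mathrm g\le n}$ be the projection according to $\mathrm g$. Let $$R=\mathrm{id}-F^{-1}\bigl(\pi_{\mathrm g\le n}\circ F^{\star}(\mathrm{id})\bigr),\qquad Q=F^{\star}(\mathrm{id})-\pi_{\mathrm g\le n}\circ F^{\star}(\mathrm{id})$$ be the remainder and pre-remainder, respectively, associated with the map-truncate-invert endomorphism $F^{-1}\circ\pi_{\mathrm g\le n}\circ F^{\star}(\mathrm{id})$. Then $$R=\frac1{c_1}Q+\mathrm{h.o.t.},$$ where $\mathrm{h.o.t.}$ denotes an endomorphism that annihilates every word $w$ with $\mathrm g(w)\le n+1$.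
   Context: $\mathbb A$ is an alphabet, $\mathbb A^*$ the set of words over $\mathbb A$ (with empty word $\mathbf 1$), $\mathbb R\langle\mathbb A\rangle$ the real vector space with basis $\mathbb A^*$. Given a commutative associative product $[\cdot,\cdot]$ on the span of the letters, the quasi-shuffle product $*$ on $\mathbb R\langle\mathbb A\rangle$ is the bilinear product with $u*\mathbf 1=\mathbf 1*u=u$ and $ua*vb=(u*vb)a+(ua*v)b+(u*v)[a,b]$ for words $u,v$ and letters $a,b$. The convolution product of linear endomorphisms $X,Y$ of $\mathbb R\langle\mathbb A\rangle$ is $(X\star Y)(w)=\sum_{uv=w}X(u)*Y(v)$, the sum being over all factorizations of the word $w$ by concatenation (including empty factors); its unit $\nu$ fixes $\mathbf 1$ and sends nonempty words to $0$. $\mathfrak J=\mathrm{id}-\nu$. A grading is a map $\mathrm g:\mathbb A^*\to\mathbb Z_{\ge0}$ that is positive on nonempty words and $0$ on $\mathbf 1$. It is preserved by $*$ if for all words $u,v$ the polynomial $u*v$ is a linear combination of words of grade $\mathrm g(u)+\mathrm g(v)$. $\pi_{\mathrm g\le n}$ is the linear projection fixing words of grade $\le n$ and sending all other words to $0$. For the power series above, $F^{\star}(\mathrm{id})=\sum_{k\ge1}c_k\mathfrak J^{\star k}$ (a finite sum on each word), and for an endomorphism $X$ with $X(\mathbf 1)=0$, $F^{-1}(X)=\nu+\sum_{k\ge1}b_kX^{\star k}$. *)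

theory Defs
  imports "HOL-Analysis.Analysis" "HOL-Analysis.Finite_Function_Topology" "HOL-Computational_Algebra.Formal_Power_Series"
begin

text \<open>
  The alphabet is a type \<open>'a\<close>. The span of the letters is \<open>'a \<Rightarrow>\<^sub>0 real\<close> and the space
  of noncommutative polynomials is \<open>'a list \<Rightarrow>\<^sub>0 real\<close>, with the real vector space structure of
  \<^theory>\<open>HOL-Analysis.Finite_Function_Topology\<close>.
\<close>

type_synonym 'a letters = "'a \<Rightarrow>\<^sub>0 real"
type_synonym 'a ncpoly = "'a list \<Rightarrow>\<^sub>0 real"
type_synonym 'a endo = "'a ncpoly \<Rightarrow> 'a ncpoly"

abbreviation basis :: "'b \<Rightarrow> ('b \<Rightarrow>\<^sub>0 real)" where
  "basis x \<equiv> Poly_Mapping.single x 1"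

definition lin_ext :: "('b \<Rightarrow> 'c::real_vector) \<Rightarrow> ('b \<Rightarrow>\<^sub>0 real) \<Rightarrow> 'c" where
  "lin_ext f p = (\<Sum>x\<in>Poly_Mapping.keys p. Poly_Mapping.lookup p x *\<^sub>R f x)"

lemma lookup_scaleR: "Poly_Mapping.lookup (r *\<^sub>R p) x = r *\<^sub>R Poly_Mapping.lookup p x"
  by (simp add: scaleR_poly_mapping_def)

lemma lin_ext_superset:
  assumes "finite S" "Poly_Mapping.keys p \<subseteq> S"
  shows "lin_ext f p = (\<Sum>x\<in>S. Poly_Mapping.lookup p x *\<^sub>R f x)"
  unfolding lin_ext_def
  by (rule sum.mono_neutral_left) (use assms in \<open>auto simp: in_keys_iff\<close>)

lemma linear_lin_ext:
  fixes f :: "'b \<Rightarrow> 'c::real_vector"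
  shows "linear (lin_ext f)"
proof (rule linearI)
  fix p q :: "'b \<Rightarrow>\<^sub>0 real" and r :: real
  let ?S = "Poly_Mapping.keys p \<union> Poly_Mapping.keys q"
  have sub: "Poly_Mapping.keys (p + q) \<subseteq> ?S" by (rule keys_add)
  show "lin_ext f (p + q) = lin_ext f p + lin_ext f q"
    by (simp add: lin_ext_superset[OF _ sub] lin_ext_superset[of ?S p] lin_ext_superset[of ?S q]
        lookup_add scaleR_add_left sum.distrib)
  have "Poly_Mapping.keys (r *\<^sub>R p) \<subseteq> Poly_Mapping.keys p"
    by (auto simp: in_keys_iff lookup_scaleR)
  then show "lin_ext f (r *\<^sub>R p) = r *\<^sub>R lin_ext f p"
    by (simp add: lin_ext_superset[of "Poly_Mapping.keys p"] lookup_scaleR scaleR_sum_right)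
qed

lemma lin_ext_basis [simp]: "lin_ext f (basis x) = f x"
  by (simp add: lin_ext_def)

lemma lin_ext_zero [simp]: "lin_ext f 0 = 0"
  by (simp add: lin_ext_def)

definition snoc_mult :: "'a ncpoly \<Rightarrow> 'a letters \<Rightarrow> 'a ncpoly" where
  "snoc_mult p l = lin_ext (\<lambda>w. lin_ext (\<lambda>a. basis (w @ [a])) l) p"

fun qsh_word :: "('a letters \<Rightarrow> 'a letters \<Rightarrow> 'a letters) \<Rightarrow> 'a list \<Rightarrow> 'a list \<Rightarrow> 'a ncpoly" where
  "qsh_word br u v =
    (if u = [] then basis v
     else if v = [] then basis u
     else snoc_mult (qsh_word br (butlast u) v) (basis (last u))
        + snoc_mult (qsh_word br u (butlast v)) (basis (last v))
        + snoc_mult (qsh_word br (butlast u) (butlast v)) (br (basis (last u)) (basis (last v))))"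

declare qsh_word.simps [simp del]

lemma qsh_word_Nil [simp]: "qsh_word br [] v = basis v" "qsh_word br u [] = basis u"
  by (simp_all add: qsh_word.simps)

lemma qsh_word_snoc:
  "qsh_word br (u @ [a]) (v @ [b]) =
     snoc_mult (qsh_word br u (v @ [b])) (basis a)
   + snoc_mult (qsh_word br (u @ [a]) v) (basis b)
   + snoc_mult (qsh_word br u v) (br (basis a) (basis b))"
  by (subst qsh_word.simps) simp

definition quasi_shuffle ::
  "('a letters \<Rightarrow> 'a letters \<Rightarrow> 'a letters) \<Rightarrow> 'a ncpoly \<Rightarrow> 'a ncpoly \<Rightarrow> 'a ncpoly" where
  "quasi_shuffle br p q = lin_ext (\<lambda>u. lin_ext (\<lambda>v. qsh_word br u v) q) p"

lemma quasi_shuffle_basis [simp]: "quasi_shuffle br (basis u) (basis v) = qsh_word br u v"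
  by (simp add: quasi_shuffle_def)

lemma quasi_shuffle_zero [simp]: "quasi_shuffle br 0 q = 0" "quasi_shuffle br p 0 = 0"
  by (simp_all add: quasi_shuffle_def) (simp add: lin_ext_def)

definition convolution ::
  "('a letters \<Rightarrow> 'a letters \<Rightarrow> 'a letters) \<Rightarrow> 'a endo \<Rightarrow> 'a endo \<Rightarrow> 'a endo" where
  "convolution br X Y =
    lin_ext (\<lambda>w. \<Sum>(u, v)\<in>{(u, v). u @ v = w}. quasi_shuffle br (X (basis u)) (Y (basis v)))"

definition conv_unit :: "'a endo" where
  "conv_unit = lin_ext (\<lambda>w. if w = [] then basis [] else 0)"

primrec conv_power ::
  "('a letters \<Rightarrow> 'a letters \<Rightarrow> 'a letters) \<Rightarrow> 'a endo \<Rightarrow> nat \<Rightarrow> 'a endo" where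
  "conv_power br X 0 = conv_unit"
| "conv_power br X (Suc k) = convolution br X (conv_power br X k)"

definition aug_id :: "'a endo" where
  "aug_id p = p - conv_unit p"

text \<open>
  The series \<open>\<Sum>k\<ge>1. c k X\<^bsup>\<star>k\<^esup>\<close>, evaluated on each word as the sum of its nonzero terms.
  If \<open>X\<close> annihilates the empty word there are only finitely many of these,
  by \<open>finite_conv_series_support\<close> below.
\<close>

definition conv_series ::
  "('a letters \<Rightarrow> 'a letters \<Rightarrow> 'a letters) \<Rightarrow> (nat \<Rightarrow> real) \<Rightarrow> 'a endo \<Rightarrow> 'a endo" where
  "conv_series br c X =
    lin_ext (\<lambda>w. \<Sum>k\<in>{k. 1 \<le> k \<and> c k *\<^sub>R conv_power br X k (basis w) \<noteq> 0}.
                    c k *\<^sub>R conv_power br X k (basis w))"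

lemma conv_power_eq_0:
  assumes "X (basis []) = 0" "length w < k"
  shows "conv_power br X k (basis w) = 0"
  using assms(2)
proof (induction k arbitrary: w)
  case (Suc k)
  have "quasi_shuffle br (X (basis u)) (conv_power br X k (basis v)) = 0" if "u @ v = w" for u v
  proof (cases "u = []")
    case False
    with that Suc.prems have "length v < k" by (cases u) auto
    with Suc.IH show ?thesis by simp
  qed (simp add: assms(1))
  then show ?case by (auto simp: convolution_def intro!: sum.neutral)
qed simp

lemma finite_conv_series_support:
  assumes "X (basis []) = 0"
  shows "finite {k. 1 \<le> k \<and> c k *\<^sub>R conv_power br X k (basis w) \<noteq> 0}"
proof (rule finite_subset)
  show "{k. 1 \<le> k \<and> c k *\<^sub>R conv_power br X k (basis w) \<noteq> 0} \<subseteq> {..length w}"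
    using conv_power_eq_0[where X = X and br = br and w = w] assms by (force simp: not_less[symmetric])
qed simp

definition F_star ::
  "('a letters \<Rightarrow> 'a letters \<Rightarrow> 'a letters) \<Rightarrow> (nat \<Rightarrow> real) \<Rightarrow> 'a endo" where
  "F_star br c = conv_series br c aug_id"

definition F_inv ::
  "('a letters \<Rightarrow> 'a letters \<Rightarrow> 'a letters) \<Rightarrow> (nat \<Rightarrow> real) \<Rightarrow> 'a endo \<Rightarrow> 'a endo" where
  "F_inv br b X p = conv_unit p + conv_series br b X p"

definition grading :: "('a list \<Rightarrow> nat) \<Rightarrow> bool" where
  "grading g \<longleftrightarrow> g [] = 0 \<and> (\<forall>w. w \<noteq> [] \<longrightarrow> g w > 0)"

definition grading_preserved ::
  "('a letters \<Rightarrow> 'a letters \<Rightarrow> 'a letters) \<Rightarrow> ('a list \<Rightarrow> nat) \<Rightarrow> bool" where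
  "grading_preserved br g \<longleftrightarrow>
    (\<forall>u v. \<forall>w\<in>Poly_Mapping.keys (quasi_shuffle br (basis u) (basis v)). g w = g u + g v)"

definition proj_le :: "('a list \<Rightarrow> nat) \<Rightarrow> nat \<Rightarrow> 'a endo" where
  "proj_le g n = lin_ext (\<lambda>w. if g w \<le> n then basis w else 0)"

definition remainder ::
  "('a letters \<Rightarrow> 'a letters \<Rightarrow> 'a letters) \<Rightarrow> (nat \<Rightarrow> real) \<Rightarrow> (nat \<Rightarrow> real) \<Rightarrow>
    ('a list \<Rightarrow> nat) \<Rightarrow> nat \<Rightarrow> 'a endo" where
  "remainder br c b g n p = p - F_inv br b (proj_le g n \<circ> F_star br c) p"

definition pre_remainder ::
  "('a letters \<Rightarrow> 'a letters \<Rightarrow> 'a letters) \<Rightarrow> (nat \<Rightarrow> real) \<Rightarrow>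
    ('a list \<Rightarrow> nat) \<Rightarrow> nat \<Rightarrow> 'a endo" where
  "pre_remainder br c g n p = F_star br c p - (proj_le g n \<circ> F_star br c) p"

text \<open>
  The first series is \<open>f (1 + x)\<close>, the second \<open>f\<^sup>-\<^sup>1 (x)\<close>. They are mutually inverse in the sense that
  \<open>f\<^sup>-\<^sup>1 (f (1 + x)) = 1 + x\<close> and \<open>f (1 + (f\<^sup>-\<^sup>1 (x) - 1)) = x\<close>.
\<close>

definition map_fps :: "(nat \<Rightarrow> real) \<Rightarrow> real fps" where
  "map_fps c = Abs_fps (\<lambda>k. if k = 0 then 0 else c k)"

definition inv_fps :: "(nat \<Rightarrow> real) \<Rightarrow> real fps" where
  "inv_fps b = Abs_fps (\<lambda>k. if k = 0 then 1 else b k)"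

definition inverse_series :: "(nat \<Rightarrow> real) \<Rightarrow> (nat \<Rightarrow> real) \<Rightarrow> bool" where
  "inverse_series c b \<longleftrightarrow>
    fps_compose (inv_fps b) (map_fps c) = 1 + fps_X \<and>
    fps_compose (map_fps c) (inv_fps b - 1) = fps_X"

end

theory Submission
  imports Defs
begin

text \<open>
  The coefficient of \<open>uv\<close> in \<open>u * v\<close> is positive, since the words of maximal length in \<open>u * v\<close> come
  from the ordinary shuffle product. So a preserved grading is additive under concatenation, and
  \<open>P = F\<^sup>\<star>(id)\<close> preserves it. Hence \<open>P' = \<pi> \<circ> P\<close> agrees with \<open>P\<close> on words of grade at most \<open>n\<close>,
  and the convolution powers of \<open>P\<close> and \<open>P'\<close> with exponent other than \<open>1\<close> agree up to grade \<open>n + 1\<close>.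
  Associativity of the convolution product gives \<open>F\<^sup>-\<^sup>1(P) = id\<close>, so on words of grade at most \<open>n + 1\<close>
  only the linear term \<open>b\<^sub>1 (P - P') = Q / c\<^sub>1\<close> of \<open>R = F\<^sup>-\<^sup>1(P) - F\<^sup>-\<^sup>1(P')\<close> survives.
\<close>

unbundle no vec_syntax
unbundle fps_syntax

section \<open>Linear extension, supports and bilinearity\<close>

text \<open>Every \<open>p\<close> is the finite combination \<open>lin_ext basis p\<close>, so a
  linear map is determined by its values on basis elements. Multilinear identities below are reduced
  to words this way.\<close>

lemma linear_ext_basis:
  fixes f h :: "('b \<Rightarrow>\<^sub>0 real) \<Rightarrow> 'c::real_vector"
  assumes "linear f" "linear h" "\<And>x. f (basis x) = h (basis x)"
  shows "f p = h p"
proof -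
  have eq: "f p = lin_ext (\<lambda>x. f (basis x)) p" if "linear f" for f :: "('b \<Rightarrow>\<^sub>0 real) \<Rightarrow> 'c"
  proof -
    have "lin_ext basis p = p"
    proof (rule poly_mapping_eqI)
      fix x
      have "Poly_Mapping.lookup (lin_ext basis p) x
        = (\<Sum>y\<in>Poly_Mapping.keys p. if y = x then Poly_Mapping.lookup p y else 0)"
        unfolding lin_ext_def lookup_sum lookup_scaleR
        by (intro sum.cong) (auto simp: lookup_single when_def)
      also have "\<dots> = Poly_Mapping.lookup p x"
        by (simp add: sum.delta in_keys_iff)
      finally show "Poly_Mapping.lookup (lin_ext basis p) x = Poly_Mapping.lookup p x" .
    qed
    then have "f p = f (lin_ext basis p)" by simp
    also have "\<dots> = lin_ext (\<lambda>x. f (basis x)) p"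
      unfolding lin_ext_def using that by (simp add: linear_sum linear_cmul)
    finally show ?thesis .
  qed
  show ?thesis using eq[OF assms(1)] eq[OF assms(2)] assms(3) by simp
qed

text \<open>Supplies linearity in the second argument of products given by nested
  \<open>lin_ext\<close>, where that argument enters only through the extended function.\<close>

lemma linear_lin_ext_param:
  assumes "\<And>x. linear (F x)"
  shows "linear (\<lambda>q. lin_ext (\<lambda>x. F x q) p)"
  unfolding lin_ext_def
  by (intro linear_compose_sum ballI linear_compose_scale_right) (rule assms)

lemma keys_sum_subset: "Poly_Mapping.keys (sum f A) \<subseteq> (\<Union>x\<in>A. Poly_Mapping.keys (f x))"
proof
  fix y assume "y \<in> Poly_Mapping.keys (sum f A)"
  then have "(\<Sum>x\<in>A. Poly_Mapping.lookup (f x) y) \<noteq> 0" by (simp add: in_keys_iff lookup_sum)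
  then obtain x where "x \<in> A" "Poly_Mapping.lookup (f x) y \<noteq> 0"
    by (rule sum.not_neutral_contains_not_neutral)
  then show "y \<in> (\<Union>x\<in>A. Poly_Mapping.keys (f x))" by (auto simp: in_keys_iff)
qed

lemma keys_lin_ext: "Poly_Mapping.keys (lin_ext f p) \<subseteq> (\<Union>x\<in>Poly_Mapping.keys p. Poly_Mapping.keys (f x))"
  unfolding lin_ext_def
  by (rule order_trans[OF keys_sum_subset]) (auto simp: in_keys_iff lookup_scaleR)

lemma bilinear_snoc_mult: "bilinear snoc_mult"
  unfolding bilinear_def snoc_mult_def
  by (intro allI conjI linear_lin_ext_param) (rule linear_lin_ext)+

lemma bilinear_quasi_shuffle: "bilinear (quasi_shuffle br)"
  unfolding bilinear_def quasi_shuffle_def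
  by (intro allI conjI linear_lin_ext_param) (rule linear_lin_ext)+

lemma bilinear_compose_linear_left:
  assumes "bilinear B" "linear f"
  shows "linear (\<lambda>x. B (f x) q)"
  using linear_compose[OF assms(2), of "\<lambda>x. B x q"] assms(1) by (simp add: bilinear_def o_def)

lemma bilinear_compose_linear_right:
  assumes "bilinear B" "linear f"
  shows "linear (\<lambda>x. B p (f x))"
  using linear_compose[OF assms(2), of "B p"] assms(1) by (simp add: bilinear_def o_def)

lemmas linear_snoc_mult =
  bilinear_compose_linear_left[OF bilinear_snoc_mult]
  bilinear_compose_linear_right[OF bilinear_snoc_mult]
lemmas linear_quasi_shuffle =
  bilinear_compose_linear_left[OF bilinear_quasi_shuffle]
  bilinear_compose_linear_right[OF bilinear_quasi_shuffle]
lemmas snoc_mult_add =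
  bilinear_ladd[OF bilinear_snoc_mult] bilinear_radd[OF bilinear_snoc_mult]
lemmas quasi_shuffle_add =
  bilinear_ladd[OF bilinear_quasi_shuffle] bilinear_radd[OF bilinear_quasi_shuffle]
lemmas quasi_shuffle_scaleR =
  bilinear_lmul[OF bilinear_quasi_shuffle] bilinear_rmul[OF bilinear_quasi_shuffle]

lemma quasi_shuffle_sum_left:
  "quasi_shuffle br (\<Sum>i\<in>A. f i) q = (\<Sum>i\<in>A. quasi_shuffle br (f i) q)"
  using linear_sum[OF linear_quasi_shuffle(1)[OF linear_id]] by (simp add: id_def)

lemma quasi_shuffle_sum_right:
  "quasi_shuffle br p (\<Sum>i\<in>A. f i) = (\<Sum>i\<in>A. quasi_shuffle br p (f i))"
  using linear_sum[OF linear_quasi_shuffle(2)[OF linear_id]] by (simp add: id_def)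

lemma quasi_shuffle_Nil [simp]:
  "quasi_shuffle br (basis []) p = p" "quasi_shuffle br p (basis []) = p"
  by (rule linear_ext_basis; auto intro!: linear_quasi_shuffle linear_ident)+

lemma snoc_mult_basis [simp]: "snoc_mult (basis w) (basis a) = basis (w @ [a])"
  by (simp add: snoc_mult_def)

section \<open>Associativity of the quasi-shuffle product\<close>

text \<open>The recursion freed from words: iterated products produce polynomials in place of words
  and brackets in place of letters. The arguments are extended one at a time from basis
  elements.\<close>

lemma quasi_shuffle_snoc:
  assumes "bilinear br"
  shows "quasi_shuffle br (snoc_mult p l) (snoc_mult q m) =
     snoc_mult (quasi_shuffle br p (snoc_mult q m)) l
   + snoc_mult (quasi_shuffle br (snoc_mult p l) q) m
   + snoc_mult (quasi_shuffle br p q) (br l m)" (is "?L p l q m = ?R p l q m")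
proof -
  note lin = linear_compose_add linear_snoc_mult linear_quasi_shuffle
    bilinear_compose_linear_left[OF assms] bilinear_compose_linear_right[OF assms] linear_ident
  have 1: "?L (basis u) (basis a) (basis v) (basis d) = ?R (basis u) (basis a) (basis v) (basis d)"
    for u a v d
    by (simp add: qsh_word_snoc)
  have 2: "?L (basis u) (basis a) (basis v) m = ?R (basis u) (basis a) (basis v) m" for u a v m
    by (rule linear_ext_basis[of "?L (basis u) (basis a) (basis v)" "?R (basis u) (basis a) (basis v)"])
      (intro lin 1)+
  have 3: "?L (basis u) (basis a) q m = ?R (basis u) (basis a) q m" for u a q m
    by (rule linear_ext_basis[of "\<lambda>q. ?L (basis u) (basis a) q m" "\<lambda>q. ?R (basis u) (basis a) q m"])
      (intro lin 2)+
  have 4: "?L (basis u) l q m = ?R (basis u) l q m" for u l q m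
    by (rule linear_ext_basis[of "\<lambda>l. ?L (basis u) l q m" "\<lambda>l. ?R (basis u) l q m"])
      (intro lin 3)+
  show ?thesis
    by (rule linear_ext_basis[of "\<lambda>p. ?L p l q m" "\<lambda>p. ?R p l q m"]) (intro lin 4)+
qed

text \<open>Induction on the total length. Either bracketing expands into seven terms, one for each
  nonempty subset of the last letters \<open>a\<close>, \<open>d\<close>, \<open>e\<close>. They
  match by induction, the full subset also by associativity of \<open>br\<close>.\<close>

lemma qsh_word_assoc:
  assumes "bilinear br" and "\<And>x y z. br (br x y) z = br x (br y z)"
  shows "quasi_shuffle br (qsh_word br u v) (basis w) = quasi_shuffle br (basis u) (qsh_word br v w)"
proof (induction "length u + length v + length w" arbitrary: u v w rule: less_induct)
  case less
  show ?case
  proof (cases "u = [] \<or> v = [] \<or> w = []")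
    case True
    then show ?thesis by auto
  next
    case False
    then obtain u' a v' d w' e where uvw: "u = u' @ [a]" "v = v' @ [d]" "w = w' @ [e]"
      by (metis rev_exhaust)
    note snoc = quasi_shuffle_snoc[OF assms(1)]
    let ?q = "quasi_shuffle br"
    have IH: "?q (?q (basis x) (basis y)) (basis z) = ?q (basis x) (?q (basis y) (basis z))"
      if "length x + length y + length z < length u + length v + length w" for x y z
      using less.hyps[OF that] by simp
    let ?u = "snoc_mult (basis u') (basis a)" and ?v = "snoc_mult (basis v') (basis d)"
      and ?w = "snoc_mult (basis w') (basis e)"
    \<comment> \<open>Two expansions give nine terms; the three with last factor
      \<open>basis e\<close> recombine into one product with \<open>basis w'\<close>. In
      \<open>R\<close> the three with last factor \<open>basis a\<close> recombine.\<close>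
    have L: "?q (?q ?u ?v) ?w =
        snoc_mult (?q (?q (basis u') ?v) ?w) (basis a)
      + snoc_mult (?q (?q ?u (basis v')) ?w) (basis d)
      + snoc_mult (?q (?q ?u ?v) (basis w')) (basis e)
      + snoc_mult (?q (?q (basis u') (basis v')) ?w) (br (basis a) (basis d))
      + snoc_mult (?q (?q (basis u') ?v) (basis w')) (br (basis a) (basis e))
      + snoc_mult (?q (?q ?u (basis v')) (basis w')) (br (basis d) (basis e))
      + snoc_mult (?q (?q (basis u') (basis v')) (basis w')) (br (br (basis a) (basis d)) (basis e))"
      unfolding snoc[of "basis u'" "basis a" "basis v'" "basis d"] quasi_shuffle_add snoc snoc_mult_add
      by (simp only: ac_simps)
    have R: "?q ?u (?q ?v ?w) =
        snoc_mult (?q (basis u') (?q ?v ?w)) (basis a)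
      + snoc_mult (?q ?u (?q (basis v') ?w)) (basis d)
      + snoc_mult (?q ?u (?q ?v (basis w'))) (basis e)
      + snoc_mult (?q (basis u') (?q (basis v') ?w)) (br (basis a) (basis d))
      + snoc_mult (?q (basis u') (?q ?v (basis w'))) (br (basis a) (basis e))
      + snoc_mult (?q ?u (?q (basis v') (basis w'))) (br (basis d) (basis e))
      + snoc_mult (?q (basis u') (?q (basis v') (basis w'))) (br (basis a) (br (basis d) (basis e)))"
      unfolding snoc[of "basis v'" "basis d" "basis w'" "basis e"] quasi_shuffle_add snoc snoc_mult_add
      by (simp only: ac_simps)
    have "?q (?q ?u ?v) ?w = ?q ?u (?q ?v ?w)"
      unfolding L R by (simp add: IH assms(2) uvw del: quasi_shuffle_basis)
    then show ?thesis by (simp add: uvw)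
  qed
qed

lemma quasi_shuffle_assoc:
  assumes "bilinear br" and "\<And>x y z. br (br x y) z = br x (br y z)"
  shows "quasi_shuffle br (quasi_shuffle br p q) r = quasi_shuffle br p (quasi_shuffle br q r)"
    (is "?L p q r = ?R p q r")
proof -
  note lin = linear_quasi_shuffle linear_ident
  have 1: "?L (basis u) (basis v) (basis w) = ?R (basis u) (basis v) (basis w)" for u v w
    using qsh_word_assoc[OF assms] by simp
  have 2: "?L (basis u) (basis v) r = ?R (basis u) (basis v) r" for u v r
    by (rule linear_ext_basis[of "?L (basis u) (basis v)" "?R (basis u) (basis v)"]) (intro lin 1)+
  have 3: "?L (basis u) q r = ?R (basis u) q r" for u q r
    by (rule linear_ext_basis[of "\<lambda>q. ?L (basis u) q r" "\<lambda>q. ?R (basis u) q r"]) (intro lin 2)+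
  show ?thesis
    by (rule linear_ext_basis[of "\<lambda>p. ?L p q r" "\<lambda>p. ?R p q r"]) (intro lin 3)+
qed

section \<open>The convolution algebra\<close>

lemma finite_splits: "finite {(u, v). u @ v = (w::'a list)}"
proof (rule finite_subset)
  show "{(u, v). u @ v = w} \<subseteq> (\<lambda>i. (take i w, drop i w)) ` {..length w}"
  proof clarify
    fix u v assume "w = u @ v"
    then show "(u, v) \<in> (\<lambda>i. (take i (u @ v), drop i (u @ v))) ` {..length (u @ v)}"
      by (intro image_eqI[of _ _ "length u"]) auto
  qed
qed simp

lemma convolution_basis:
  "convolution br X Y (basis w) =
    (\<Sum>(u, v)\<in>{(u, v). u @ v = w}. quasi_shuffle br (X (basis u)) (Y (basis v)))"
  by (simp add: convolution_def)

lemma linear_convolution: "linear (convolution br X Y)"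
  unfolding convolution_def by (rule linear_lin_ext)

lemma linear_conv_unit: "linear conv_unit"
  unfolding conv_unit_def by (rule linear_lin_ext)

lemma conv_unit_basis [simp]: "conv_unit (basis w) = (if w = [] then basis [] else 0)"
  by (simp add: conv_unit_def)

lemma linear_conv_power: "linear (conv_power br X k)"
  by (cases k) (simp_all add: linear_conv_unit linear_convolution)

text \<open>Both sides sum over the factorizations of a word into three factors; regrouping these
  leaves associativity of the quasi-shuffle product.\<close>

lemma convolution_assoc:
  fixes br :: "'a letters \<Rightarrow> 'a letters \<Rightarrow> 'a letters"
  assumes "bilinear br" and "\<And>x y z. br (br x y) z = br x (br y z)"
  shows "convolution br (convolution br X Y) Z = convolution br X (convolution br Y Z)"
proof
  fix p
  let ?q = "quasi_shuffle br"
  show "convolution br (convolution br X Y) Z p = convolution br X (convolution br Y Z) p"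
  proof (rule linear_ext_basis[OF linear_convolution linear_convolution])
    fix w :: "'a list"
    have "convolution br (convolution br X Y) Z (basis w) =
      (\<Sum>(s, t)\<in>(SIGMA s:{(u, v). u @ v = w}. {(u, v). u @ v = fst s}).
        ?q (?q (X (basis (fst t))) (Y (basis (snd t)))) (Z (basis (snd s))))"
      by (subst sum.Sigma[symmetric])
        (auto simp: convolution_basis quasi_shuffle_sum_left finite_splits split_beta)
    also have "\<dots> = (\<Sum>(s, t)\<in>(SIGMA s:{(u, v). u @ v = w}. {(u, v). u @ v = snd s}).
        ?q (X (basis (fst s))) (?q (Y (basis (fst t))) (Z (basis (snd t)))))"
      by (rule sum.reindex_bij_witness[of _ "\<lambda>((u, x), (v, y)). ((u @ v, y), (u, v))"
            "\<lambda>((x, y), (u, v)). ((u, v @ y), (v, y))"])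
        (auto simp: quasi_shuffle_assoc[OF assms])
    also have "\<dots> = convolution br X (convolution br Y Z) (basis w)"
      by (subst sum.Sigma[symmetric])
        (auto simp: convolution_basis quasi_shuffle_sum_right finite_splits split_beta)
    finally show "convolution br (convolution br X Y) Z (basis w)
      = convolution br X (convolution br Y Z) (basis w)" .
  qed
qed

lemma convolution_unit_left:
  fixes X :: "'a endo"
  assumes "linear X"
  shows "convolution br conv_unit X = X"
proof
  fix p
  show "convolution br conv_unit X p = X p"
  proof (rule linear_ext_basis[OF linear_convolution assms])
    fix w :: "'a list"
    have "convolution br conv_unit X (basis w) = (\<Sum>(u, v)\<in>{([] :: 'a list, w)}. X (basis v))"
      unfolding convolution_basis
      by (rule sum.mono_neutral_cong_right) (auto simp: finite_splits split: if_splits)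
    then show "convolution br conv_unit X (basis w) = X (basis w)" by simp
  qed
qed

text \<open>Stated on words only: a convolution is linear by construction, while \<open>X\<close> is
  arbitrary.\<close>

lemma conv_power_one_basis:
  fixes X :: "'a endo"
  shows "conv_power br X (Suc 0) (basis w) = X (basis w)"
proof -
  have "convolution br X conv_unit (basis w) = (\<Sum>(u, v)\<in>{(w, [] :: 'a list)}. X (basis u))"
    unfolding convolution_basis
    by (rule sum.mono_neutral_cong_right) (auto simp: finite_splits split: if_splits)
  then show ?thesis by simp
qed

lemma conv_power_add:
  assumes "bilinear br" and "\<And>x y z. br (br x y) z = br x (br y z)"
  shows "convolution br (conv_power br X i) (conv_power br X j) = conv_power br X (i + j)"
  by (induction i) (simp_all add: convolution_unit_left linear_conv_power convolution_assoc[OF assms])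

section \<open>Power series in the convolution product\<close>

text \<open>Replaces the support, which depends on the word, by any cutoff \<open>N\<close> at least
  its length, so that sums for different words share an index range.\<close>

lemma conv_series_basis:
  assumes "X (basis []) = 0" "length w \<le> N"
  shows "conv_series br c X (basis w) = (\<Sum>k=1..N. c k *\<^sub>R conv_power br X k (basis w))"
  unfolding conv_series_def lin_ext_basis
  by (rule sum.mono_neutral_left)
    (use assms conv_power_eq_0[of X w _ br] in \<open>force simp: not_le[symmetric]\<close>)+

lemma linear_conv_series: "linear (conv_series br c X)"
  unfolding conv_series_def by (rule linear_lin_ext)

lemma aug_id_Nil [simp]: "aug_id (basis []) = 0"
  by (simp add: aug_id_def)

lemma F_star_Nil [simp]: "F_star br c (basis []) = 0"
  using conv_series_basis[of aug_id "[]" 0 br c] by (simp add: F_star_def)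

text \<open>Index 0 is included, with coefficient 0, so that the coefficients are those of a formal
  power series.\<close>

lemma F_star_basis:
  assumes "length w \<le> N"
  shows "F_star br c (basis w) = (\<Sum>k\<le>N. (map_fps c $ k) *\<^sub>R conv_power br aug_id k (basis w))"
proof -
  have "F_star br c (basis w) = (\<Sum>k=1..N. c k *\<^sub>R conv_power br aug_id k (basis w))"
    unfolding F_star_def by (rule conv_series_basis) (use assms in auto)
  also have "\<dots> = (\<Sum>k\<le>N. (map_fps c $ k) *\<^sub>R conv_power br aug_id k (basis w))"
    by (rule sum.mono_neutral_cong_left) (auto simp: map_fps_def)
  finally show ?thesis .
qed

lemma F_inv_basis:
  assumes "X (basis []) = 0" "length w \<le> N"
  shows "F_inv br b X (basis w) = (\<Sum>k\<le>N. (inv_fps b $ k) *\<^sub>R conv_power br X k (basis w))"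
proof -
  have "(\<Sum>k\<le>N. (inv_fps b $ k) *\<^sub>R conv_power br X k (basis w))
    = conv_unit (basis w) + (\<Sum>k=1..N. (inv_fps b $ k) *\<^sub>R conv_power br X k (basis w))"
    unfolding atMost_atLeast0
    by (subst sum.atLeast_Suc_atMost) (simp_all add: inv_fps_def)
  also have "(\<Sum>k=1..N. (inv_fps b $ k) *\<^sub>R conv_power br X k (basis w))
    = (\<Sum>k=1..N. b k *\<^sub>R conv_power br X k (basis w))"
    by (rule sum.cong) (auto simp: inv_fps_def)
  finally show ?thesis
    using conv_series_basis[of X w N br b] assms by (simp add: F_inv_def)
qed

text \<open>Evaluating power series at \<open>aug_id\<close> turns multiplication into convolution:
  powers of \<open>aug_id\<close> add exponents, so coefficients combine by the Cauchy
  product.\<close>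

lemma conv_power_F_star:
  assumes "bilinear br" and "\<And>x y z. br (br x y) z = br x (br y z)"
    and "length w \<le> N"
  shows "conv_power br (F_star br c) r (basis w) =
    (\<Sum>k\<le>N. (map_fps c ^ r $ k) *\<^sub>R conv_power br aug_id k (basis w))"
  using assms(3)
proof (induction r arbitrary: w)
  case 0
  have "(\<Sum>k\<le>N. ((1::real fps) $ k) *\<^sub>R conv_power br aug_id k (basis w))
    = (\<Sum>k\<in>{0}. conv_power br aug_id k (basis w))"
    by (rule sum.mono_neutral_cong_right) auto
  then show ?case by simp
next
  case (Suc r)
  let ?J = "\<lambda>k w. conv_power br aug_id k (basis w)" and ?q = "quasi_shuffle br"
  let ?C = "map_fps c"
  have le_N: "k \<le> N" if "?J k w \<noteq> 0" for k
    using that Suc.prems conv_power_eq_0[of aug_id w k br] by force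
  have "conv_power br (F_star br c) (Suc r) (basis w) =
    (\<Sum>(u, v)\<in>{(u, v). u @ v = w}. \<Sum>i\<le>N. \<Sum>j\<le>N. (?C $ i * ?C ^ r $ j) *\<^sub>R ?q (?J i u) (?J j v))"
    unfolding conv_power.simps convolution_basis
  proof (rule sum.cong[OF refl], clarify)
    fix u v :: "'a list" assume w: "w = u @ v"
    \<comment> \<open>Neither factor is longer than \<open>w\<close>, so the cutoff \<open>N\<close>
      serves both.\<close>
    then have "length u \<le> N" "length v \<le> N" using Suc.prems by auto
    then show "?q (F_star br c (basis u)) (conv_power br (F_star br c) r (basis v))
      = (\<Sum>i\<le>N. \<Sum>j\<le>N. (?C $ i * ?C ^ r $ j) *\<^sub>R ?q (?J i u) (?J j v))"
      by (simp add: F_star_basis Suc.IH quasi_shuffle_sum_left quasi_shuffle_sum_right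
          quasi_shuffle_scaleR scaleR_sum_right) (subst sum.swap, simp add: mult.commute)
  qed
  also have "\<dots> = (\<Sum>i\<le>N. \<Sum>j\<le>N. \<Sum>(u, v)\<in>{(u, v). u @ v = w}. (?C $ i * ?C ^ r $ j) *\<^sub>R ?q (?J i u) (?J j v))"
    unfolding split_beta by (subst sum.swap) (intro sum.cong refl, rule sum.swap)
  also have "\<dots> = (\<Sum>i\<le>N. \<Sum>j\<le>N. (?C $ i * ?C ^ r $ j) *\<^sub>R ?J (i + j) w)"
    unfolding conv_power_add[OF assms(1,2), symmetric] convolution_basis
    by (simp add: scaleR_sum_right split_beta)
  also have "\<dots> = (\<Sum>(i, j)\<in>{..N} \<times> {..N}. (?C $ i * ?C ^ r $ j) *\<^sub>R ?J (i + j) w)"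
    by (rule sum.cartesian_product)
  \<comment> \<open>The square shrinks to a triangle, since powers of \<open>aug_id\<close> beyond
    \<open>N\<close> vanish on \<open>w\<close>.\<close>
  also have "\<dots> = (\<Sum>(i, j)\<in>{(i, j). i + j \<le> N}. (?C $ i * ?C ^ r $ j) *\<^sub>R ?J (i + j) w)"
    by (rule sum.mono_neutral_right)
      (auto intro: le_N)
  also have "\<dots> = (\<Sum>k\<le>N. \<Sum>i\<le>k. (?C $ i * ?C ^ r $ (k - i)) *\<^sub>R ?J (i + (k - i)) w)"
    by (rule sum.triangle_reindex_eq)
  also have "\<dots> = (\<Sum>k\<le>N. (?C ^ Suc r $ k) *\<^sub>R ?J k w)"
    by (intro sum.cong refl) (simp add: fps_mult_nth scaleR_sum_left atMost_atLeast0)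
  finally show ?case .
qed

text \<open>Substituting one series into the other gives \<open>1 + fps_X\<close>, whose value at
  \<open>aug_id\<close> is \<open>conv_unit\<close> plus \<open>aug_id\<close>, the
  identity.\<close>

lemma F_inv_F_star:
  assumes "bilinear br" and "\<And>x y z. br (br x y) z = br x (br y z)"
    and "inverse_series c b"
  shows "F_inv br b (F_star br c) (basis w) = basis w"
proof -
  \<comment> \<open>The successor keeps index 1 in range even for the empty word.\<close>
  define N where "N = Suc (length w)"
  let ?J = "\<lambda>k. conv_power br aug_id k (basis w)" and ?C = "map_fps c" and ?B = "inv_fps b"
  have "F_inv br b (F_star br c) (basis w) =
    (\<Sum>r\<le>N. \<Sum>k\<le>N. (?B $ r * ?C ^ r $ k) *\<^sub>R ?J k)"
    by (simp add: F_inv_basis[where N = N] conv_power_F_star[OF assms(1,2), where N = N] N_def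
        scaleR_sum_right del: sum.atMost_Suc)
  also have "\<dots> = (\<Sum>k\<le>N. (\<Sum>r\<le>N. ?B $ r * ?C ^ r $ k) *\<^sub>R ?J k)"
    by (subst sum.swap) (simp add: scaleR_sum_left)
  also have "\<dots> = (\<Sum>k\<le>N. ((?B oo ?C) $ k) *\<^sub>R ?J k)"
  proof (intro sum.cong refl arg_cong2[where f = scaleR])
    fix k assume "k \<in> {..N}"
    \<comment> \<open>\<open>map_fps c\<close> has no constant term, so its \<open>r\<close>-th
      power starts in degree \<open>r\<close>; the sum up to \<open>N\<close> thus reduces to the
      one up to \<open>k\<close> that defines composition.\<close>
    moreover have "?C ^ r $ k = 0" if "k < r" for r
      using startsby_zero_power_prefix[of ?C r] that by (simp add: map_fps_def)
    ultimately show "(\<Sum>r\<le>N. ?B $ r * ?C ^ r $ k) = (?B oo ?C) $ k"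
      unfolding fps_compose_nth by (intro sum.mono_neutral_right) auto
  qed
  also have "\<dots> = (\<Sum>k\<le>N. ((1 + fps_X :: real fps) $ k) *\<^sub>R ?J k)"
    using assms(3) by (simp add: inverse_series_def)
  also have "\<dots> = (\<Sum>k\<in>{0, Suc 0}. ?J k)"
    by (rule sum.mono_neutral_cong_right) (auto simp: N_def fps_X_def)
  also have "\<dots> = basis w"
    using conv_power_one_basis[of br aug_id w] by (simp add: aug_id_def)
  finally show ?thesis .
qed

section \<open>Coefficients of longest words and additivity of the grading\<close>

lemma lookup_snoc_mult:
  "Poly_Mapping.lookup (snoc_mult p l) [] = 0"
  "Poly_Mapping.lookup (snoc_mult p l) (w @ [a]) = Poly_Mapping.lookup p w * Poly_Mapping.lookup l a"
proof -
  have *: "Poly_Mapping.lookup (lin_ext (\<lambda>a. basis (v @ [a])) l) (w @ [a])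
    = (if v = w then Poly_Mapping.lookup l a else 0)" for v :: "'a list" and w a
  proof -
    have "Poly_Mapping.lookup (lin_ext (\<lambda>a. basis (v @ [a])) l) (w @ [a])
      = (\<Sum>x\<in>Poly_Mapping.keys l. if x = a then (if v = w then Poly_Mapping.lookup l x else 0) else 0)"
      unfolding lin_ext_def lookup_sum lookup_scaleR
      by (intro sum.cong) (auto simp: lookup_single when_def)
    then show ?thesis by (simp add: in_keys_iff)
  qed
  show "Poly_Mapping.lookup (snoc_mult p l) [] = 0"
    by (simp add: snoc_mult_def lin_ext_def lookup_sum lookup_scaleR lookup_single)
  have "Poly_Mapping.lookup (snoc_mult p l) (w @ [a])
    = (\<Sum>v\<in>Poly_Mapping.keys p. if v = w then Poly_Mapping.lookup p v * Poly_Mapping.lookup l a else 0)"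
    unfolding snoc_mult_def lin_ext_def[of _ p] lookup_sum lookup_scaleR *
    by (intro sum.cong) auto
  then show "Poly_Mapping.lookup (snoc_mult p l) (w @ [a])
    = Poly_Mapping.lookup p w * Poly_Mapping.lookup l a"
    by (simp add: in_keys_iff)
qed

text \<open>Mirrors the recursion of \<open>qsh_word\<close>: one induction hypothesis for each of
  its three terms.\<close>

lemma snoc_pair_induct [case_names Nil_left Nil_right snoc]:
  assumes "\<And>v. P [] v" "\<And>u. P u []"
    and "\<And>u a v d. P u (v @ [d]) \<Longrightarrow> P (u @ [a]) v \<Longrightarrow> P u v \<Longrightarrow> P (u @ [a]) (v @ [d])"
  shows "P u v"
proof (induction u arbitrary: v rule: rev_induct)
  case (snoc a u)
  note * = this
  show ?case by (induction v rule: rev_induct) (auto intro: assms *)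
qed (rule assms)

text \<open>Each shuffle term trades one letter for one, the bracket term two for one. This is what
  removes the bracket, whose coefficients may have any sign, from the count of longest
  words.\<close>

lemma lookup_qsh_word_long:
  "length u + length v < length w \<Longrightarrow> Poly_Mapping.lookup (qsh_word br u v) w = 0"
proof (induction u v arbitrary: w rule: snoc_pair_induct)
  case (snoc u a v d)
  then obtain w' e where w: "w = w' @ [e]" by (cases w rule: rev_cases) auto
  then show ?case using snoc by (simp add: qsh_word_snoc lookup_add lookup_snoc_mult)
qed (auto simp: lookup_single when_def)

lemma lookup_qsh_word_nonneg:
  "length w = length u + length v \<Longrightarrow> Poly_Mapping.lookup (qsh_word br u v) w \<ge> 0"
proof (induction u v arbitrary: w rule: snoc_pair_induct)
  case (snoc u a v d)
  then obtain w' e where w: "w = w' @ [e]" by (cases w rule: rev_cases) auto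
  then show ?case using snoc
    by (simp add: qsh_word_snoc lookup_add lookup_snoc_mult lookup_single when_def lookup_qsh_word_long)
qed (auto simp: lookup_single when_def)

lemma lookup_qsh_word_append: "Poly_Mapping.lookup (qsh_word br u v) (u @ v) > 0"
proof (induction u v rule: snoc_pair_induct)
  case (snoc u a v d)
  \<comment> \<open>The term that strips \<open>d\<close> is positive by induction. The term that
    strips \<open>a\<close> contributes only if \<open>a = d\<close>, and then
    nonnegatively.\<close>
  have "Poly_Mapping.lookup (qsh_word br u (v @ [d])) (u @ [a] @ v) \<ge> 0"
    by (rule lookup_qsh_word_nonneg) simp
  then show ?case using snoc lookup_snoc_mult(2)[of _ _ "u @ a # v" d]
    by (simp add: qsh_word_snoc lookup_add lookup_single when_def lookup_qsh_word_long add_nonneg_pos)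
qed auto

lemma grading_append:
  assumes "grading_preserved br g"
  shows "g (u @ v) = g u + g v"
proof -
  have "u @ v \<in> Poly_Mapping.keys (quasi_shuffle br (basis u) (basis v))"
    using lookup_qsh_word_append[of br u v] by (simp add: in_keys_iff)
  with assms show ?thesis unfolding grading_preserved_def by blast
qed

section \<open>Grade preservation by convolution powers and series\<close>

lemma quasi_shuffle_graded:
  assumes "grading_preserved br g"
    and "\<And>w. w \<in> Poly_Mapping.keys p \<Longrightarrow> g w = i" "\<And>w. w \<in> Poly_Mapping.keys q \<Longrightarrow> g w = j"
    and "w \<in> Poly_Mapping.keys (quasi_shuffle br p q)"
  shows "g w = i + j"
proof -
  obtain u where u: "u \<in> Poly_Mapping.keys p" "w \<in> Poly_Mapping.keys (lin_ext (qsh_word br u) q)"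
    using assms(4) keys_lin_ext unfolding quasi_shuffle_def by fast
  then obtain v where "v \<in> Poly_Mapping.keys q" "w \<in> Poly_Mapping.keys (qsh_word br u v)"
    using keys_lin_ext by fast
  then show ?thesis using assms(1-3) u(1) by (simp add: grading_preserved_def)
qed

text \<open>The power multiplies factors of \<open>w\<close> back together. Their grades add up to
  \<open>g w\<close> by additivity under concatenation, and the product preserves this sum.\<close>

lemma conv_power_aug_id_graded:
  assumes "grading_preserved br g"
  shows "v \<in> Poly_Mapping.keys (conv_power br aug_id k (basis w)) \<Longrightarrow> g v = g w"
proof (induction k arbitrary: v w)
  case 0
  then show ?case by (auto split: if_splits)
next
  case (Suc k)
  from subsetD[OF keys_sum_subset Suc.prems[unfolded conv_power.simps convolution_basis]]
  obtain x y where w: "w = x @ y"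
    and v: "v \<in> Poly_Mapping.keys (quasi_shuffle br (aug_id (basis x)) (conv_power br aug_id k (basis y)))"
    by auto
  have "g v = g x + g y"
    by (rule quasi_shuffle_graded[OF assms(1) _ _ v])
      (auto simp: aug_id_def intro: Suc.IH split: if_splits)
  then show ?case by (simp add: w grading_append[OF assms(1)])
qed

lemma F_star_graded:
  assumes "grading_preserved br g"
    and "v \<in> Poly_Mapping.keys (F_star br c (basis w))"
  shows "g v = g w"
proof -
  obtain k where "v \<in> Poly_Mapping.keys ((map_fps c $ k) *\<^sub>R conv_power br aug_id k (basis w))"
    using assms(2) keys_sum_subset unfolding F_star_basis[OF order_refl] by fast
  then have "v \<in> Poly_Mapping.keys (conv_power br aug_id k (basis w))"
    by (auto simp: in_keys_iff lookup_scaleR)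
  then show ?thesis by (rule conv_power_aug_id_graded[OF assms(1)])
qed

section \<open>Truncation and comparison of convolution powers\<close>

lemma linear_proj_le: "linear (proj_le g n)"
  unfolding proj_le_def by (rule linear_lin_ext)

lemma proj_le_id:
  assumes "\<And>w. w \<in> Poly_Mapping.keys p \<Longrightarrow> g w \<le> n"
  shows "proj_le g n p = p"
proof -
  have "proj_le g n p = lin_ext basis p"
    unfolding proj_le_def lin_ext_def by (intro sum.cong refl) (use assms in auto)
  also have "\<dots> = p"
    by (rule linear_ext_basis) (simp_all add: linear_lin_ext linear_ident)
  finally show ?thesis .
qed

text \<open>By additivity, no factor of a word has a larger grade than the word.\<close>

lemma conv_power_cong_le:
  assumes "grading_preserved br g"
    and "\<And>w. g w \<le> n \<Longrightarrow> X (basis w) = Y (basis w)"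
    and "g w \<le> n"
  shows "conv_power br X k (basis w) = conv_power br Y k (basis w)"
  using assms(3)
proof (induction k arbitrary: w)
  case (Suc k)
  show ?case unfolding conv_power.simps convolution_basis
    by (rule sum.cong) (use Suc assms(2) in \<open>auto simp: grading_append[OF assms(1)]\<close>)
qed simp

text \<open>In a power other than the first, a word of grade \<open>n + 1\<close> is split into at least two factors,
  and only the nonempty ones, all of grade at most \<open>n\<close>, contribute.\<close>

lemma conv_power_cong_Suc:
  assumes "grading g" "grading_preserved br g"
    and "\<And>w. g w \<le> n \<Longrightarrow> X (basis w) = Y (basis w)"
    and "X (basis []) = 0" "g w \<le> n + 1" "k \<noteq> 1"
  shows "conv_power br X k (basis w) = conv_power br Y k (basis w)"
proof (cases k)
  case (Suc l)
  then have "l \<ge> 1" using assms(6) by simp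
  have Y: "Y (basis []) = 0" using assms(1,3,4) by (metis grading_def le0)
  have "quasi_shuffle br (X (basis u)) (conv_power br X l (basis v))
    = quasi_shuffle br (Y (basis u)) (conv_power br Y l (basis v))" if "u @ v = w" for u v
  proof (cases "u = [] \<or> v = []")
    \<comment> \<open>If \<open>u\<close> is empty, \<open>X\<close> and \<open>Y\<close> kill it;
      if \<open>v\<close> is empty, their \<open>l\<close>-th powers do, as \<open>l\<close> is
      positive.\<close>
    case True
    then show ?thesis
      using assms(4) Y \<open>l \<ge> 1\<close> conv_power_eq_0[of X "[]" l br] conv_power_eq_0[of Y "[]" l br] by auto
  next
    case False
    then have "g u > 0" "g v > 0" "g u + g v \<le> n + 1"
      using assms(1,5) that grading_append[OF assms(2), of u v] by (auto simp: grading_def)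
    then have "g u \<le> n" "g v \<le> n" by auto
    then show ?thesis using assms(3) conv_power_cong_le[where X = X and Y = Y and n = n, OF assms(2,3)] by simp
  qed
  then show ?thesis
    unfolding Suc conv_power.simps convolution_basis by (intro sum.cong refl) auto
qed simp

theorem lemma2:
  fixes br :: "'a letters \<Rightarrow> 'a letters \<Rightarrow> 'a letters"
    and c b :: "nat \<Rightarrow> real"
    and g :: "'a list \<Rightarrow> nat"
    and n :: nat
  assumes "bilinear br"
    and "\<And>x y. br x y = br y x"
    and "\<And>x y z. br (br x y) z = br x (br y z)"
    and "inverse_series c b"
    and "b 1 = 1 / c 1"
    and "grading g"
    and "grading_preserved br g"
  shows "\<exists>hot :: 'a endo. linear hot \<and>
           (\<forall>w. g w \<le> n + 1 \<longrightarrow> hot (basis w) = 0) \<and>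
           remainder br c b g n = (\<lambda>p. (1 / c 1) *\<^sub>R pre_remainder br c g n p + hot p)"
proof -
  define P where "P = F_star br c"
  define P' where "P' = proj_le g n \<circ> P"
  \<comment> \<open>With \<open>hot\<close> taken as the difference, the decomposition is immediate;
    linearity and vanishing remain.\<close>
  define hot where "hot p = remainder br c b g n p - (1 / c 1) *\<^sub>R pre_remainder br c g n p" for p
  have linP: "linear P" unfolding P_def F_star_def by (rule linear_conv_series)
  have linP': "linear P'" unfolding P'_def by (rule linear_compose[OF linP linear_proj_le])
  have "linear hot"
    unfolding hot_def remainder_def pre_remainder_def F_inv_def P_def[symmetric] P'_def[symmetric]
    by (intro linear_compose_sub linear_compose_add linear_compose_scale_right linear_ident
        linear_conv_unit linear_conv_series linP linP')
  moreover have "hot (basis w) = 0" if w: "g w \<le> n + 1" for w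
  proof -
    define N where "N = Suc (length w)"
    let ?B = "inv_fps b"
    have agree: "P (basis v) = P' (basis v)" if "g v \<le> n" for v
      using F_star_graded[OF assms(7)] that unfolding P'_def P_def o_def
      by (intro proj_le_id[symmetric]) metis
    have P: "P (basis []) = 0" by (simp add: P_def)
    then have P': "P' (basis []) = 0" by (simp add: P'_def proj_le_def)
    \<comment> \<open>Writing the identity as \<open>F_inv\<close> of \<open>P\<close> lets both
      parts be compared term by term in one series.\<close>
    have "remainder br c b g n (basis w) = F_inv br b P (basis w) - F_inv br b P' (basis w)"
      by (simp add: remainder_def P'_def P_def F_inv_F_star[OF assms(1,3,4)])
    also have "\<dots> = (\<Sum>k\<le>N. (?B $ k) *\<^sub>R (conv_power br P k (basis w) - conv_power br P' k (basis w)))"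
      by (simp add: F_inv_basis[where N = N] P P' N_def sum_subtractf scaleR_diff_right
          del: sum.atMost_Suc)
    \<comment> \<open>Only \<open>k = 1\<close> remains: all other powers of \<open>P\<close> and
      \<open>P'\<close> agree on \<open>w\<close>.\<close>
    also have "\<dots> = (\<Sum>k\<in>{Suc 0}. (?B $ k) *\<^sub>R (conv_power br P k (basis w) - conv_power br P' k (basis w)))"
      by (rule sum.mono_neutral_right)
        (auto simp: N_def conv_power_cong_Suc[where X = P and Y = P' and n = n, OF assms(6,7) agree P w])
    also have "\<dots> = b 1 *\<^sub>R (P (basis w) - P' (basis w))"
      by (simp add: conv_power_one_basis inv_fps_def del: conv_power.simps)
    finally show ?thesis
      using assms(5) by (simp add: hot_def pre_remainder_def P'_def P_def)
  qed
  ultimately show ?thesis by (intro exI[of _ hot]) (auto simp: hot_def)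
qed

end
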